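(* Suppose nodal voltage magnitudes are given by the LinDistFlow model $v=v^\bullet\mathbf{1}+L^{-1}p$, where $L=(R+\kappa X)^{-1}=W\Lambda W^{\mathsf T}$. Suppose the nodal injections are $p=p_\star+\tilde p$, where $p_\star\in\mathbb{R}^n$ is deterministic and $\tilde p_1,\dots,\tilde p_n$ are independent random variables with $\underline{p}\le\tilde p_i\le\overline{p}$ almost surely for all $i$, for constants $\underline p<\overline p$, and put $\Delta:=\overline{p}-\underline{p}$. Then for each $i\in\mathcal{N}=\{1,\dots,n\}$, the random variable $v_i-v^\bullet$ is sub-Gaussian with parameter $\frac12\Delta\|\Lambda^{-1}w_i\|_2$.
   Context: A random variable $z\in\mathbb{R}$ is sub-Gaussian with parameter $\sigma$ if $\mathbb{E}[e^{s(z-\mathbb{E}[z])}]\le e^{s^2\sigma^2/2}$ for all $s\in\mathbb{R}$. A radial (tree) distribution network has a slack node, $n$ further nodes $\mathcal{N}=\{1,\dots,n\}$, and $n$ lines. $A\in\{-1,0,1\}^{n\times n}$ is the edge-to-node incidence matrix with the slack column removed; it is square and invertible because the network is a tree. $r,x\in\mathbb{R}^n$ are the vectors of line resistances and reactances (nonzero entries), $R:=(A^{\mathsf T}\operatorname{diag}(r)^{-1}A)^{-1}$ and $X:=(A^{\mathsf T}\operatorname{diag}(x)^{-1}A)^{-1}$. The LinDistFlow approximation of the voltage magnitudes is $v=v^\bullet\mathbf{1}+Rp+Xq$, where $p,q\in\mathbb{R}^n$ are the active and reactive injections and the scalar $v^\bullet$ is the nominal slack voltage. The ratio $\kappa=q_i/p_i$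 is the same real number for all nodes (so $q=\kappa p$), and $r_e+\kappa x_e\neq0$ for every line $e$, so that $R+\kappa X$ is invertible. $L:=(R+\kappa X)^{-1}$ is real symmetric, with eigendecomposition $L=W\Lambda W^{\mathsf T}$, where $W\in\mathbb{R}^{n\times n}$ is orthogonal and $\Lambda=\operatorname{diag}(\lambda_1,\dots,\lambda_n)$. The vector $w_i\in\mathbb{R}^n$ is the $i$-th row of $W$ written as a column vector. All quantities refer to a single fixed sampling round. *)

theory Defs
  imports "HOL-Probability.Probability"
begin

subsection \<open>Radial networks\<close>

text \<open>
  Lines form an undirected multigraph: line \<open>e\<close> joins \<open>src e\<close> and \<open>dst e\<close>; this orientation is
  an arbitrary reference direction. A walk may traverse a line in either direction.
\<close>

fun line_walk :: "('e \<Rightarrow> 'v) \<Rightarrow> ('e \<Rightarrow> 'v) \<Rightarrow> 'v \<Rightarrow> 'e list \<Rightarrow> 'v \<Rightarrow> bool" where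
  "line_walk src dst u [] v \<longleftrightarrow> u = v"
| "line_walk src dst u (e # es) v \<longleftrightarrow>
     (src e = u \<and> line_walk src dst (dst e) es v) \<or>
     (dst e = u \<and> line_walk src dst (src e) es v)"

text \<open>
  A multigraph contains a cycle (including self-loops and pairs of parallel lines) iff it has a
  nonempty closed walk without repeated lines.
\<close>

definition radial :: "('e \<Rightarrow> 'v) \<Rightarrow> ('e \<Rightarrow> 'v) \<Rightarrow> bool" where
  "radial src dst \<longleftrightarrow>
     (\<forall>u v. \<exists>es. line_walk src dst u es v) \<and>
     \<not> (\<exists>u es. es \<noteq> [] \<and> distinct es \<and> line_walk src dst u es u)"

text \<open>
  The nodes are \<open>'n option\<close>, with \<open>None\<close> the slack node, whose column is left out below.
  Rows are indexed by lines and columns by non-slack nodes.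
\<close>

definition incidence :: "('e::finite \<Rightarrow> 'n::finite option) \<Rightarrow> ('e \<Rightarrow> 'n option) \<Rightarrow> real ^ 'n ^ 'e" where
  "incidence src dst =
     (\<chi> e i. (if src e = Some i then 1 else 0) - (if dst e = Some i then 1 else 0))"

definition diag :: "real ^ 'n \<Rightarrow> real ^ 'n ^ 'n" where
  "diag d = (\<chi> i j. if i = j then d $ i else 0)"

text \<open>\<open>R\<close> and \<open>X\<close> are obtained with the line resistances and reactances, respectively.\<close>

definition sensitivity :: "real ^ 'n ^ 'n \<Rightarrow> real ^ 'n \<Rightarrow> real ^ 'n ^ 'n" where
  "sensitivity A z = matrix_inv (transpose A ** matrix_inv (diag z) ** A)"

definition lindistflow ::
  "real \<Rightarrow> real ^ 'n ^ 'n \<Rightarrow> real ^ 'n ^ 'n \<Rightarrow> real ^ 'n \<Rightarrow> real ^ 'n \<Rightarrow> real ^ 'n" where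
  "lindistflow v0 R X p q = vec v0 + R *v p + X *v q"

subsection \<open>Sub-Gaussian random variables\<close>

text \<open>
  Integrability is explicit because the Bochner integral of a non-integrable function is \<open>0\<close>.
\<close>

definition sub_gaussian :: "'a measure \<Rightarrow> ('a \<Rightarrow> real) \<Rightarrow> real \<Rightarrow> bool" where
  "sub_gaussian M z \<sigma> \<longleftrightarrow>
     integrable M z \<and>
     (\<forall>s::real.
        integrable M (\<lambda>\<omega>. exp (s * (z \<omega> - integral\<^sup>L M z))) \<and>
        (\<integral>\<omega>. exp (s * (z \<omega> - integral\<^sup>L M z)) \<partial>M) \<le> exp (s\<^sup>2 * \<sigma>\<^sup>2 / 2))"

subsection \<open>Well-definedness of the inverses\<close>

lemma matrix_inv_unique:
  fixes A B :: "real ^ 'n ^ 'n"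
  assumes "A ** B = mat 1"
  shows "matrix_inv A = B"
proof -
  have BA: "B ** A = mat 1"
    using assms by (simp add: matrix_left_right_inverse)
  have "invertible A"
    using assms BA by (auto simp: invertible_def)
  hence "matrix_inv A ** A = mat 1"
    unfolding invertible_def matrix_inv_def by (rule someI2_ex) auto
  hence "matrix_inv A ** A ** B = B"
    by simp
  thus ?thesis
    by (simp add: matrix_mul_assoc[symmetric] assms)
qed

lemma invertible_iff_matrix_inv:
  fixes A :: "real ^ 'n ^ 'n"
  shows "invertible A \<longleftrightarrow> A ** matrix_inv A = mat 1 \<and> matrix_inv A ** A = mat 1"
proof
  assume "invertible A"
  then obtain B where B: "A ** B = mat 1" "B ** A = mat 1"
    unfolding invertible_def by blast
  show "A ** matrix_inv A = mat 1 \<and> matrix_inv A ** A = mat 1"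
    using B matrix_inv_unique[OF B(1)] by simp
qed (auto simp: invertible_def)

lemma diag_mult_diag: "diag a ** diag b = diag (\<chi> i. a $ i * b $ i)"
proof -
  have "(\<Sum>k\<in>UNIV. (if i = k then a $ i else 0) * (if k = j then b $ k else 0)) =
        (\<Sum>k\<in>UNIV. if k = i then a $ i * (if i = j then b $ i else 0) else 0)" for i j
    by (intro sum.cong) auto
  thus ?thesis
    by (simp add: diag_def matrix_matrix_mult_def vec_eq_iff)
qed

lemma diag_inverse:
  assumes "\<And>i. d $ i \<noteq> 0"
  shows "diag d ** diag (\<chi> i. inverse (d $ i)) = mat 1"
    and "matrix_inv (diag d) = diag (\<chi> i. inverse (d $ i))"
proof -
  show *: "diag d ** diag (\<chi> i. inverse (d $ i)) = mat 1"
    using assms unfolding diag_mult_diag by (simp add: diag_def mat_def vec_eq_iff)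
  thus "matrix_inv (diag d) = diag (\<chi> i. inverse (d $ i))"
    by (rule matrix_inv_unique)
qed

lemma invertible_incidence:
  fixes src dst :: "'n::finite \<Rightarrow> 'n option"
  assumes "radial src dst"
  shows "invertible (incidence src dst)"
proof -
  have "y = 0" if y: "incidence src dst *v y = 0" for y :: "real ^ 'n"
  proof -
    define pot where "pot u = (case u of None \<Rightarrow> 0 | Some i \<Rightarrow> y $ i)" for u
    have pot: "pot u = (\<Sum>i\<in>UNIV. (if u = Some i then 1 else 0) * y $ i)" for u :: "'n option"
      by (cases u) (auto simp: pot_def if_distrib if_distribR cong: if_cong)
    have step: "pot (src e) = pot (dst e)" for e
    proof -
      have "(incidence src dst *v y) $ e = pot (src e) - pot (dst e)"
        by (simp add: incidence_def matrix_vector_mult_def pot left_diff_distrib sum_subtractf)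
      thus ?thesis using y by simp
    qed
    have walk: "pot u = pot v" if "line_walk src dst u es v" for u es v
      using that by (induction es arbitrary: u) (fastforce simp: step)+
    have "pot (Some i) = pot None" for i
      using assms walk unfolding radial_def by metis
    thus "y = 0" by (simp add: pot_def vec_eq_iff)
  qed
  hence "\<exists>B. B ** incidence src dst = mat 1"
    by (simp add: matrix_left_invertible_ker)
  thus ?thesis
    unfolding invertible_def using matrix_left_right_inverse by blast
qed

lemma sensitivity_eq:
  assumes "invertible A" "\<And>e. z $ e \<noteq> 0"
  shows "transpose A ** matrix_inv (diag z) ** A ** sensitivity A z = mat 1"
    and "sensitivity A z = matrix_inv A ** diag z ** transpose (matrix_inv A)"
proof -
  let ?B = "matrix_inv A" and ?D = "matrix_inv (diag z)"
  have A: "A ** ?B = mat 1" and "?B ** A = mat 1"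
    using assms(1) by (simp_all add: invertible_iff_matrix_inv)
  hence At: "transpose A ** transpose ?B = mat 1"
    by (metis matrix_transpose_mul transpose_mat)
  have D: "?D ** diag z = mat 1"
    using diag_inverse[OF assms(2)] by (metis matrix_left_right_inverse)
  have "transpose A ** ?D ** A ** (?B ** diag z ** transpose ?B)
        = transpose A ** (?D ** ((A ** ?B) ** (diag z ** transpose ?B)))"
    by (simp only: matrix_mul_assoc)
  also have "\<dots> = transpose A ** ((?D ** diag z) ** transpose ?B)"
    by (simp add: A matrix_mul_assoc)
  also have "\<dots> = mat 1" by (simp add: D At)
  finally have *: "transpose A ** ?D ** A ** (?B ** diag z ** transpose ?B) = mat 1" .
  show eq: "sensitivity A z = ?B ** diag z ** transpose ?B"
    unfolding sensitivity_def using * by (rule matrix_inv_unique)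
  show "transpose A ** ?D ** A ** sensitivity A z = mat 1"
    unfolding eq by (rule *)
qed

lemma invertible_combined_sensitivity:
  fixes A :: "real ^ 'n ^ 'n"
  assumes "invertible A" "\<And>e. r $ e \<noteq> 0" "\<And>e. x $ e \<noteq> 0" "\<And>e. r $ e + \<kappa> * x $ e \<noteq> 0"
  shows "invertible (sensitivity A r + \<kappa> *\<^sub>R sensitivity A x)"
proof -
  have d: "diag r + \<kappa> *\<^sub>R diag x = diag (r + \<kappa> *\<^sub>R x)"
    by (simp add: diag_def vec_eq_iff)
  have distrib: "(P + Q) ** C = P ** C + Q ** C" "(k *\<^sub>R P) ** C = k *\<^sub>R (P ** C)"
    "C ** (k *\<^sub>R P) = k *\<^sub>R (C ** P)" for P Q C :: "real ^ 'n ^ 'n" and k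
    by (simp_all add: matrix_matrix_mult_def vec_eq_iff distrib_right sum.distrib
        sum_distrib_left mult.assoc mult.left_commute)
  have "sensitivity A r + \<kappa> *\<^sub>R sensitivity A x = sensitivity A (r + \<kappa> *\<^sub>R x)"
    using assms by (simp add: sensitivity_eq(2) d[symmetric] matrix_add_ldistrib distrib)
  moreover have "invertible (sensitivity A (r + \<kappa> *\<^sub>R x))"
  proof -
    have "transpose A ** matrix_inv (diag (r + \<kappa> *\<^sub>R x)) ** A
          ** sensitivity A (r + \<kappa> *\<^sub>R x) = mat 1"
      using assms by (intro sensitivity_eq(1)) auto
    thus ?thesis
      unfolding invertible_def using matrix_left_right_inverse by blast
  qed
  ultimately show ?thesis by simp
qed

text \<open>With a common ratio \<open>q = \<kappa> p\<close>, the LinDistFlow model takes the form \<open>v\<^sub>0 1 + L\<^sup>-\<^sup>1 p\<close>.\<close>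

lemma lindistflow_const_ratio:
  fixes src dst :: "'n::finite \<Rightarrow> 'n option" and r x p :: "real ^ 'n"
  assumes "radial src dst"
    and "\<And>e. r $ e \<noteq> 0" "\<And>e. x $ e \<noteq> 0" "\<And>e. r $ e + \<kappa> * x $ e \<noteq> 0"
  defines "R \<equiv> sensitivity (incidence src dst) r" and "X \<equiv> sensitivity (incidence src dst) x"
  shows "lindistflow v0 R X p (\<kappa> *\<^sub>R p) = vec v0 + matrix_inv (matrix_inv (R + \<kappa> *\<^sub>R X)) *v p"
proof -
  have "invertible (R + \<kappa> *\<^sub>R X)"
    unfolding R_def X_def
    by (intro invertible_combined_sensitivity invertible_incidence assms)
  hence "matrix_inv (matrix_inv (R + \<kappa> *\<^sub>R X)) = R + \<kappa> *\<^sub>R X"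
    by (intro matrix_inv_unique) (simp add: invertible_iff_matrix_inv)
  thus ?thesis
    by (simp add: lindistflow_def matrix_vector_mult_add_rdistrib matrix_vector_mult_scaleR
        scaleR_matrix_vector_assoc add.assoc)
qed

end

theory Submission
  imports Defs
begin

text \<open>
  Since \<open>L\<close> is invertible, so is \<open>\<Lambda>\<close>, and \<open>L\<^sup>-\<^sup>1 = W \<Lambda>\<^sup>-\<^sup>1 W\<^sup>T\<close>. Hence \<open>v\<^sub>i - v\<^sub>0\<close> is a constant plus the linear
  combination of the independent bounded \<open>p_til\<^sub>j\<close> whose coefficient vector is the \<open>i\<close>-th row of
  \<open>L\<^sup>-\<^sup>1\<close>, namely \<open>W (\<Lambda>\<^sup>-\<^sup>1 w\<^sub>i)\<close>. By Hoeffding's lemma such a combination is sub-Gaussian with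
  parameter \<open>\<Delta> / 2\<close> times the norm of the coefficient vector, and orthogonality of \<open>W\<close> gives
  \<open>\<parallel>W (\<Lambda>\<^sup>-\<^sup>1 w\<^sub>i)\<parallel> = \<parallel>\<Lambda>\<^sup>-\<^sup>1 w\<^sub>i\<parallel>\<close>.
\<close>

text \<open>Almost surely \<open>f\<close> is no farther from its mean than the farther of the
  endpoints \<open>a\<close> and \<open>b\<close>, so the exponential is bounded almost surely on a
  probability space.\<close>

lemma (in interval_bounded_random_variable) integrable_exp_centered:
  "integrable M (\<lambda>\<omega>. exp (l * (f \<omega> - expectation f)))"
proof (rule integrable_const_bound)
  let ?c = "max \<bar>a - expectation f\<bar> \<bar>b - expectation f\<bar>"
  show "AE \<omega> in M. norm (exp (l * (f \<omega> - expectation f))) \<le> exp (\<bar>l\<bar> * ?c)"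
    using AE_in_interval
  proof eventually_elim
    case (elim \<omega>)
    have "l * (f \<omega> - expectation f) \<le> \<bar>l\<bar> * \<bar>f \<omega> - expectation f\<bar>"
      by (metis abs_ge_self abs_mult)
    also have "\<dots> \<le> \<bar>l\<bar> * ?c"
      using elim by (intro mult_left_mono) auto
    finally show ?case by simp
  qed
qed measurable

lemma (in interval_bounded_random_variable) expectation_exp_centered_le_of_pos:
  assumes "l > 0"
  shows "expectation (\<lambda>\<omega>. exp (l * (f \<omega> - expectation f))) \<le> exp (l\<^sup>2 * (b - a)\<^sup>2 / 8)"
proof -
  have "ennreal (expectation (\<lambda>\<omega>. exp (l * (f \<omega> - expectation f))))
        = (\<integral>\<^sup>+\<omega>. ennreal (exp (l * (f \<omega> - expectation f))) \<partial>M)"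
    by (intro nn_integral_eq_integral[symmetric] integrable_exp_centered) simp
  also have "\<dots> \<le> ennreal (exp (l\<^sup>2 * (b - a)\<^sup>2 / 8))"
    using assms by (rule Hoeffdings_lemma_nn_integral)
  finally show ?thesis
    by (subst (asm) ennreal_le_iff) simp_all
qed

text \<open>Negative \<open>l\<close> reduces to positive \<open>- l\<close> by passing to
  \<open>- f\<close>, whose interval has the same width; at \<open>l = 0\<close> both sides are
  1.\<close>

lemma (in interval_bounded_random_variable) expectation_exp_centered_le:
  "expectation (\<lambda>\<omega>. exp (l * (f \<omega> - expectation f))) \<le> exp (l\<^sup>2 * (b - a)\<^sup>2 / 8)"
proof (cases l "0 :: real" rule: linorder_cases)
  case less
  interpret neg: interval_bounded_random_variable M "\<lambda>\<omega>. - f \<omega>" "- b" "- a"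
    by unfold_locales (auto intro: eventually_mono[OF AE_in_interval])
  show ?thesis
    using neg.expectation_exp_centered_le_of_pos[of "- l"] less by (simp add: algebra_simps)
next
  case equal
  then show ?thesis by (simp add: prob_space)
next
  case greater
  then show ?thesis by (rule expectation_exp_centered_le_of_pos)
qed

text \<open>Centring removes \<open>d\<close>, and independence turns the expectation of the
  exponential of the sum into a product. Hoeffding's lemma with \<open>l = s * c j\<close> bounds
  each factor, and the exponents add up.\<close>

lemma (in indep_interval_bounded_random_variables) sub_gaussian_linear_combination:
  "sub_gaussian M (\<lambda>\<omega>. d + (\<Sum>j\<in>I. c j * X j \<omega>)) (1 / 2 * sqrt (\<Sum>j\<in>I. (c j * (b j - a j))\<^sup>2))"
proof -
  define m where "m = (\<lambda>j. expectation (X j))"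
  have int: "integrable M (X j)" if "j \<in> I" for j
    using interval_bounded_random_variable.integrable[OF bounded_random_variable[OF that]] .
  have mean: "expectation (\<lambda>\<omega>. d + (\<Sum>j\<in>I. c j * X j \<omega>)) = d + (\<Sum>j\<in>I. c j * m j)"
    using int by (simp add: m_def prob_space)
  have factor: "exp (s * (d + (\<Sum>j\<in>I. c j * X j \<omega>) - (d + (\<Sum>j\<in>I. c j * m j))))
      = (\<Prod>j\<in>I. exp (s * c j * (X j \<omega> - m j)))" for s \<omega>
    by (simp add: exp_sum[OF fin, symmetric] sum_subtractf sum_distrib_left algebra_simps)
  have exp_int: "integrable M (\<lambda>\<omega>. exp (l * (X j \<omega> - m j)))" if "j \<in> I" for j l
    using interval_bounded_random_variable.integrable_exp_centered[OF bounded_random_variable[OF that]]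
    by (simp add: m_def)
  have exp_le: "expectation (\<lambda>\<omega>. exp (l * (X j \<omega> - m j))) \<le> exp (l\<^sup>2 * (b j - a j)\<^sup>2 / 8)"
    if "j \<in> I" for j l
    using interval_bounded_random_variable.expectation_exp_centered_le[OF bounded_random_variable[OF that]]
    by (simp add: m_def)
  have exp_indep: "indep_vars (\<lambda>_. borel) (\<lambda>j \<omega>. exp (s * c j * (X j \<omega> - m j))) I" for s
    by (rule indep_vars_compose2[OF indep]) simp
  have "integrable M (\<lambda>\<omega>. \<Prod>j\<in>I. exp (s * c j * (X j \<omega> - m j)))" for s
    by (intro indep_vars_integrable fin exp_indep exp_int)
  moreover have "expectation (\<lambda>\<omega>. \<Prod>j\<in>I. exp (s * c j * (X j \<omega> - m j)))
      \<le> exp (s\<^sup>2 * (1 / 2 * sqrt (\<Sum>j\<in>I. (c j * (b j - a j))\<^sup>2))\<^sup>2 / 2)" for s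
  proof -
    have "expectation (\<lambda>\<omega>. \<Prod>j\<in>I. exp (s * c j * (X j \<omega> - m j)))
        = (\<Prod>j\<in>I. expectation (\<lambda>\<omega>. exp (s * c j * (X j \<omega> - m j))))"
      by (intro indep_vars_lebesgue_integral fin exp_indep exp_int)
    also have "\<dots> \<le> (\<Prod>j\<in>I. exp ((s * c j)\<^sup>2 * (b j - a j)\<^sup>2 / 8))"
      by (intro prod_mono conjI exp_le) auto
    \<comment> \<open>The 1/8 from Hoeffding's lemma is the squared factor 1/2 of the parameter,
      halved.\<close>
    also have "\<dots> = exp (s\<^sup>2 * (1 / 2 * sqrt (\<Sum>j\<in>I. (c j * (b j - a j))\<^sup>2))\<^sup>2 / 2)"
      by (simp add: exp_sum[OF fin, symmetric] power_mult_distrib sum_nonneg sum_distrib_left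
          sum_divide_distrib power_divide mult.assoc)
    finally show ?thesis .
  qed
  ultimately show ?thesis
    unfolding sub_gaussian_def mean factor using int by simp
qed

lemma sub_gaussian_cong:
  assumes "\<And>\<omega>. \<omega> \<in> space M \<Longrightarrow> y \<omega> = z \<omega>"
  shows "sub_gaussian M y \<sigma> \<longleftrightarrow> sub_gaussian M z \<sigma>"
  unfolding sub_gaussian_def
  by (simp add: assms cong: Bochner_Integration.integrable_cong Bochner_Integration.integral_cong)

lemma norm_orthogonal_matrix_mult:
  fixes W :: "real ^ 'n ^ 'n"
  assumes "orthogonal_matrix W"
  shows "norm (W *v y) = norm y"
proof -
  have "orthogonal_transformation (\<lambda>y. W *v y)"
    using assms by (simp add: orthogonal_transformation_matrix)
  thus ?thesis
    by (rule orthogonal_transformation_norm)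
qed

lemma transpose_diag: "transpose (diag d) = diag d"
  by (simp add: transpose_def diag_def vec_eq_iff)

lemma matrix_inv_orthogonal_diagonalization:
  fixes W D :: "real ^ 'n ^ 'n"
  assumes W: "orthogonal_matrix W" and inv: "invertible (W ** D ** transpose W)"
  shows "invertible D"
    and "matrix_inv (W ** D ** transpose W) = W ** matrix_inv D ** transpose W"
proof -
  have WtW: "transpose W ** W = mat 1" and WWt: "W ** transpose W = mat 1"
    using W by (simp_all add: orthogonal_matrix_def)
  \<comment> \<open>Solving for \<open>D\<close> exhibits it as a product of invertible
    matrices.\<close>
  have D: "D = transpose W ** (W ** D ** transpose W) ** W"
    by (metis WtW matrix_mul_assoc matrix_mul_lid matrix_mul_rid)
  have "invertible W" "invertible (transpose W)"
    using WtW WWt by (auto simp: invertible_def)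
  thus D_inv: "invertible D"
    by (subst D) (intro invertible_mult inv)
  have "W ** D ** transpose W ** (W ** matrix_inv D ** transpose W)
      = W ** D ** (transpose W ** W) ** matrix_inv D ** transpose W"
    by (simp only: matrix_mul_assoc)
  also have "\<dots> = W ** (D ** matrix_inv D) ** transpose W"
    by (simp add: WtW matrix_mul_assoc)
  also have "\<dots> = mat 1"
    using D_inv by (simp add: invertible_iff_matrix_inv WWt)
  finally show "matrix_inv (W ** D ** transpose W) = W ** matrix_inv D ** transpose W"
    by (rule matrix_inv_unique)
qed

text \<open>For the symmetric matrix \<Lambda> this gives symmetry of its inverse without inspecting
  the eigenvalues.\<close>

lemma transpose_matrix_inv:
  fixes B :: "real ^ 'n ^ 'n"
  assumes "invertible B"
  shows "transpose (matrix_inv B) = matrix_inv (transpose B)"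
proof -
  have "transpose B ** transpose (matrix_inv B) = mat 1"
    using assms by (metis invertible_iff_matrix_inv matrix_transpose_mul transpose_mat)
  thus ?thesis
    by (rule matrix_inv_unique[symmetric])
qed

lemma row_matrix_mult:
  fixes B :: "real ^ 'n ^ 'm" and C :: "real ^ 'k ^ 'n"
  shows "row i (B ** C) = transpose C *v row i B"
  by (simp add: row_def transpose_def matrix_matrix_mult_def matrix_vector_mult_def vec_eq_iff
      mult.commute)

theorem lemma3:
  fixes M :: "'a measure"
    and src dst :: "'n::finite \<Rightarrow> 'n option"
    and r x :: "real ^ 'n"
    and \<kappa> v\<^sub>0 p_lo p_hi \<Delta> :: real
    and A R X L W \<Lambda> :: "real ^ 'n ^ 'n"
    and lam p_star :: "real ^ 'n"
    and p_til p v :: "'a \<Rightarrow> real ^ 'n"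
    and i :: 'n
  assumes "prob_space M"
    and "radial src dst"
    and "A = incidence src dst"
    and "\<And>e. r $ e \<noteq> 0" and "\<And>e. x $ e \<noteq> 0"
    and "\<And>e. r $ e + \<kappa> * x $ e \<noteq> 0"
    and "R = sensitivity A r" and "X = sensitivity A x"
    and "L = matrix_inv (R + \<kappa> *\<^sub>R X)"
    and "orthogonal_matrix W" and "\<Lambda> = diag lam" and "L = W ** \<Lambda> ** transpose W"
    and "prob_space.indep_vars M (\<lambda>_. borel) (\<lambda>j \<omega>. p_til \<omega> $ j) UNIV"
    and "p_lo < p_hi" and "\<Delta> = p_hi - p_lo"
    and "\<And>j. AE \<omega> in M. p_lo \<le> p_til \<omega> $ j \<and> p_til \<omega> $ j \<le> p_hi"
    and "\<And>\<omega>. \<omega> \<in> space M \<Longrightarrow> p \<omega> = p_star + p_til \<omega>"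
    and "\<And>\<omega>. \<omega> \<in> space M \<Longrightarrow> v \<omega> = vec v\<^sub>0 + matrix_inv L *v p \<omega>"
  shows "sub_gaussian M (\<lambda>\<omega>. v \<omega> $ i - v\<^sub>0) (1 / 2 * \<Delta> * norm (matrix_inv \<Lambda> *v row i W))"
proof -
  interpret prob_space M by fact
  interpret indep_interval_bounded_random_variables
      M UNIV "\<lambda>j \<omega>. p_til \<omega> $ j" "\<lambda>_. p_lo" "\<lambda>_. p_hi"
    using assms(13,16) by unfold_locales auto

  \<comment> \<open>\<open>matrix_inv\<close> is an arbitrary choice on singular matrices;
    invertibility here makes \<open>L\<close>, and then \<open>matrix_inv L\<close>, genuine
    inverses.\<close>
  have "invertible (R + \<kappa> *\<^sub>R X)"
    unfolding assms(3,7,8)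
    by (intro invertible_combined_sensitivity invertible_incidence assms(2,4-6))
  hence "L ** (R + \<kappa> *\<^sub>R X) = mat 1" "(R + \<kappa> *\<^sub>R X) ** L = mat 1"
    by (simp_all add: assms(9) invertible_iff_matrix_inv)
  hence "invertible L"
    by (auto simp: invertible_def)
  hence \<Lambda>_inv: "invertible \<Lambda>" and L_inv: "matrix_inv L = W ** matrix_inv \<Lambda> ** transpose W"
    unfolding assms(12) using matrix_inv_orthogonal_diagonalization[OF assms(10)] by blast+

  define u where "u = row i (matrix_inv L)"
  \<comment> \<open>Applying \<open>row_matrix_mult\<close> twice peels off both right-hand factors,
    transposed; \<open>matrix_inv \<Lambda>\<close> is its own transpose.\<close>
  have "u = W *v (matrix_inv \<Lambda> *v row i W)"
    using transpose_matrix_inv[OF \<Lambda>_inv]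
    by (simp add: u_def L_inv row_matrix_mult transpose_transpose assms(11) transpose_diag)
  hence norm_u: "norm u = norm (matrix_inv \<Lambda> *v row i W)"
    by (simp add: norm_orthogonal_matrix_mult[OF assms(10)])

  \<comment> \<open>All intervals share one width, which leaves the root as \<Delta> itself because
    \<Delta> is positive.\<close>
  have "sqrt (\<Sum>j\<in>UNIV. (u $ j * (p_hi - p_lo))\<^sup>2) = \<Delta> * norm u"
    using assms(14,15)
    by (simp add: norm_vec_def L2_set_def power_mult_distrib sum_distrib_right[symmetric]
        real_sqrt_mult)
  hence "sub_gaussian M (\<lambda>\<omega>. u \<bullet> p_star + (\<Sum>j\<in>UNIV. u $ j * p_til \<omega> $ j)) (1 / 2 * \<Delta> * norm u)"
    using sub_gaussian_linear_combination[of "u \<bullet> p_star" "\<lambda>j. u $ j"] by (simp add: mult.assoc)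
  moreover have "v \<omega> $ i - v\<^sub>0 = u \<bullet> p_star + (\<Sum>j\<in>UNIV. u $ j * p_til \<omega> $ j)"
    if "\<omega> \<in> space M" for \<omega>
  proof -
    have "v \<omega> $ i - v\<^sub>0 = u \<bullet> (p_star + p_til \<omega>)"
      using that by (simp add: assms(17,18) u_def matrix_vector_mult_def row_def inner_vec_def)
    thus ?thesis
      \<comment> \<open>Linearity first separates the deterministic part; only then are inner
        products expanded into coordinates.\<close>
      by (simp add: inner_add_right) (simp add: inner_vec_def)
  qed
  ultimately show ?thesis
    unfolding norm_u by (subst sub_gaussian_cong)
qed

end
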